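(* Let $\mathbb K$ be a valuation field, let $C$ be the curve defined by $F(x,y)=\sum_{(i,j)\in\mathcal A}a_{ij}x^iy^j=0$ with $\mathcal A\subset\mathbb Z^2$ finite non-empty and all $a_{ij}\in\mathbb K^*$, and let $p\in(\mathbb K^* )^2$ be a point of $C$. If $\mu_p(C)=m$ and $P=\mathrm{Val}(p)$, then $\mu^{\mathrm{trop}}_P(\mathrm{Trop}(C))\ge m$, i.e. $P$ is a point of multiplicity at least $m$ on $\mathrm{Trop}(C)$ in the intermediate sense.
   Context: A valuation field is a field $\mathbb K$ with a map $\mathrm{val}:\mathbb K\to\mathbb R\cup\{-\infty\}$, with $\mathrm{val}(a)=-\infty$ iff $a=0$, $\mathrm{val}(ab)=\mathrm{val}(a)+\mathrm{val}(b)$, $\mathrm{val}(a+b)\le\max(\mathrm{val}(a),\mathrm{val}(b))$. For $p=(p_1,p_2)\in(\mathbb K^* )^2$, $\mathrm{Val}(p)=(\mathrm{val}(p_1),\mathrm{val}(p_2))$. The multiplicity $\mu_p(C)$ of $p=(p_1,p_2)$ on $C$ is the degree of the lowest term of the Taylor expansion of $F$ at $p$; equivalently the maximal $m$ with $F\in\langle x-p_1,y-p_2\rangle^m$ in the local ring of $p$. $\mathrm{Trop}(C)$ is the set of points $(X,Y)\in\mathbb R^2$ where the maximum $\max_{(i,j)\in\mathcal A}(iX+jY+\mathrm{val}(a_{ij}))$ is attained for at least two $(i,j)$. $P(\mathbb Z^2)$ is the set of directions in $\mathbb Z^2$; each direction $u$ is represented by a primitive vector $(u_1,u_2)\in\mathbb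 Z^2$, unique up to sign. For compact $B\subset\mathbb R^2$, $\omega_u(B)=\max_{x,y\in B}(u_1,u_2)\cdot(x-y)$. The lattice length of a segment parallel to a primitive integer vector $(p,q)$ is its Euclidean length divided by $\sqrt{p^2+q^2}$. A compact set $B\subset\mathbb R^2$ is $m$-thick if one of the following holds: $B$ is empty; $\mathrm{ConvHull}(B)$ is 1-dimensional, of rational slope (vertical allowed), with lattice length at least $m$; $\mathrm{ConvHull}(B)$ is 2-dimensional and for each $u\in P(\mathbb Z^2)$ with $\omega_u(\mathrm{ConvHull}(B))=m-a_u$, $a_u>0$, $\mathrm{ConvHull}(B)$ has two sides perpendicular to $u$, each of lattice length at least $a_u$. Multiplicity in the intermediate sense. Let $P=(P_1,P_2)\in\mathrm{Trop}(C)$ and put $c_{ij}=\mathrm{val}(a_{ij})+iP_1+jP_2$ (this translates $P$ to the origin; for $P=(0,0)$ one has $c_{ij}=\mathrm{val}(a_{ij})$). Let $\widetilde{\mathcal A}=\mathrm{ConvHull}\{(i,j,s):(i,j)\in\mathcal A,\ s\le c_{ij}\}\subset\mathbb R^3$ and for $\mu\in\mathbb R$ let $\widetilde{\mathcal A}_\mu$ be the projection to the first two coordinates of the section of $\widetilde{\mathcal A}$ by the plane $z=\mu$. Then $\mu^{\mathrm{trop}}_P(\mathrm{Trop}(C))\ge m$ means that $\widetilde{\mathcal A}_\mu$ is $m$-thick for every $\mu\in\mathbb R$. *)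

theory Defs
  imports "HOL-Analysis.Analysis" "HOL-Computational_Algebra.Formal_Power_Series"
begin

locale valuation_field =
  fixes val :: "'k::field \<Rightarrow> ereal"
  assumes val_neq_PInf: "val x \<noteq> \<infinity>"
    and val_eq_MInf_iff: "val x = -\<infinity> \<longleftrightarrow> x = 0"
    and val_mult: "val (x * y) = val x + val y"
    and val_add: "val (x + y) \<le> max (val x) (val y)"

(* Intended for points of the torus, where both valuations are finite. *)
definition Val :: "('k::field \<Rightarrow> ereal) \<Rightarrow> 'k \<times> 'k \<Rightarrow> real \<times> real" where
  "Val val p = (real_of_ereal (val (fst p)), real_of_ereal (val (snd p)))"

(* A Laurent polynomial is given by a finite set A of exponents and a coefficient function;
   only the coefficients at exponents in A matter. Its curve lives in the torus. *)
definition laurent_curve ::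
    "(int \<times> int) set \<Rightarrow> (int \<Rightarrow> int \<Rightarrow> 'k::field) \<Rightarrow> ('k \<times> 'k) set" where
  "laurent_curve A a =
     {(x, y). x \<noteq> 0 \<and> y \<noteq> 0 \<and> (\<Sum>(i, j)\<in>A. a i j * x powi i * y powi j) = 0}"

(* The coefficient of (x - p1)^k (y - p2)^l in the Taylor expansion at (p1, p2), p1, p2 nonzero:
   expand x^i as (p1 + X)^i and y^j as (p2 + Y)^j with X = x - p1, Y = y - p2. Negative powers are
   taken in the ring of formal power series; no factorials are inverted, so the characteristic
   is arbitrary. *)
definition taylor_coeff ::
    "(int \<times> int) set \<Rightarrow> (int \<Rightarrow> int \<Rightarrow> 'k::field) \<Rightarrow> 'k \<times> 'k \<Rightarrow> nat \<Rightarrow> nat \<Rightarrow> 'k" where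
  "taylor_coeff A a p k l =
     (\<Sum>(i, j)\<in>A. a i j * fps_nth ((fps_const (fst p) + fps_X) powi i) k
                       * fps_nth ((fps_const (snd p) + fps_X) powi j) l)"

definition curve_mult ::
    "(int \<times> int) set \<Rightarrow> (int \<Rightarrow> int \<Rightarrow> 'k::field) \<Rightarrow> 'k \<times> 'k \<Rightarrow> nat" where
  "curve_mult A a p = (LEAST n. \<exists>k l. k + l = n \<and> taylor_coeff A a p k l \<noteq> 0)"

definition trop_term ::
    "('k::field \<Rightarrow> ereal) \<Rightarrow> (int \<Rightarrow> int \<Rightarrow> 'k) \<Rightarrow> real \<times> real \<Rightarrow> int \<times> int \<Rightarrow> real" where
  "trop_term val a P = (\<lambda>(i, j). of_int i * fst P + of_int j * snd P + real_of_ereal (val (a i j)))"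

definition Trop ::
    "('k::field \<Rightarrow> ereal) \<Rightarrow> (int \<times> int) set \<Rightarrow> (int \<Rightarrow> int \<Rightarrow> 'k) \<Rightarrow> (real \<times> real) set" where
  "Trop val A a =
     {P. card {e \<in> A. trop_term val a P e = Max (trop_term val a P ` A)} \<ge> 2}"

(* Directions are represented by primitive vectors. The sign ambiguity is harmless: everything
   below is invariant under negating the vector. *)
definition primitive :: "int \<times> int \<Rightarrow> bool" where
  "primitive u \<longleftrightarrow> coprime (fst u) (snd u)"

definition real_vec :: "int \<times> int \<Rightarrow> real \<times> real" where
  "real_vec u = (of_int (fst u), of_int (snd u))"

(* For nonempty compact B the supremum is a maximum. *)
definition width :: "int \<times> int \<Rightarrow> (real \<times> real) set \<Rightarrow> real" where
  "width u B = (SUP (x, y) \<in> B \<times> B. real_vec u \<bullet> (x - y))"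

(* S is a segment parallel to the primitive vector d, and its lattice length is r. *)
definition has_lattice_length :: "(real \<times> real) set \<Rightarrow> int \<times> int \<Rightarrow> real \<Rightarrow> bool" where
  "has_lattice_length S d r \<longleftrightarrow> primitive d \<and>
     (\<exists>x y t. S = closed_segment x y \<and> y - x = t *\<^sub>R real_vec d \<and>
        r = dist x y / norm (real_vec d))"

definition side_perp :: "(real \<times> real) set \<Rightarrow> int \<times> int \<Rightarrow> real \<Rightarrow> (real \<times> real) set \<Rightarrow> bool" where
  "side_perp B u r S \<longleftrightarrow> S edge_of B \<and>
     (\<exists>d s. has_lattice_length S d s \<and> real_vec d \<bullet> real_vec u = 0 \<and> r \<le> s)"

definition thick :: "nat \<Rightarrow> (real \<times> real) set \<Rightarrow> bool" where
  "thick m B \<longleftrightarrow> compact B \<and>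
     (B = {} \<or>
      (aff_dim (convex hull B) = 1 \<and>
         (\<exists>d r. has_lattice_length (convex hull B) d r \<and> real m \<le> r)) \<or>
      (aff_dim (convex hull B) = 2 \<and>
         (\<forall>u r. primitive u \<and> r > 0 \<and> width u (convex hull B) = real m - r \<longrightarrow>
            (\<exists>S T. S \<noteq> T \<and> side_perp (convex hull B) u r S \<and> side_perp (convex hull B) u r T))))"

definition extended_hull ::
    "('k::field \<Rightarrow> ereal) \<Rightarrow> (int \<times> int) set \<Rightarrow> (int \<Rightarrow> int \<Rightarrow> 'k) \<Rightarrow> real \<times> real \<Rightarrow>
       (real \<times> real \<times> real) set" where
  "extended_hull val A a P =
     convex hull {(of_int i, of_int j, s) | i j s. (i, j) \<in> A \<and> s \<le> trop_term val a P (i, j)}"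

definition hull_section ::
    "('k::field \<Rightarrow> ereal) \<Rightarrow> (int \<times> int) set \<Rightarrow> (int \<Rightarrow> int \<Rightarrow> 'k) \<Rightarrow> real \<times> real \<Rightarrow> real \<Rightarrow>
       (real \<times> real) set" where
  "hull_section val A a P \<mu> = {(x, y). (x, y, \<mu>) \<in> extended_hull val A a P}"

definition trop_mult_at_least ::
    "('k::field \<Rightarrow> ereal) \<Rightarrow> (int \<times> int) set \<Rightarrow> (int \<Rightarrow> int \<Rightarrow> 'k) \<Rightarrow> real \<times> real \<Rightarrow> nat \<Rightarrow> bool" where
  "trop_mult_at_least val A a P m \<longleftrightarrow>
     P \<in> Trop val A a \<and> (\<forall>\<mu>. thick m (hull_section val A a P \<mu>))"

end

theory Submission
  imports Defs
begin

text \<open>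
  After rescaling the variables by the coordinates of \<open>p\<close>, the point is \<open>(1, 1)\<close>, the coefficients are
  \<open>b i j = a i j * p1\<^sup>i * p2\<^sup>j\<close>, and the heights \<open>c (i, j)\<close> in the extended hull are their valuations
  (\<open>val_term_at_Val\<close>, \<open>taylor_coeff_scaled\<close>). Multiplicity at least \<open>m\<close> says that the sum of \<open>b i j * q i j\<close>
  vanishes for \<open>q\<close> a product of binomial coefficients in \<open>i\<close> and in \<open>j\<close> of total degree less than \<open>m\<close>.
  This family of test functions spans the same space in all lattice coordinates
  (\<open>newton_lt_ibin_linear\<close>), so a given primitive direction \<open>u\<close> may be taken to be horizontal.

  Binomial coefficients have valuation at most 0, vanish on intervals of consecutive integers and are
  units next to these intervals. Fix a threshold \<open>s\<close> and look at the first column containing a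
  coefficient of valuation at least \<open>s\<close>. If \<open>d\<close> further columns reach up to the last one with such
  coefficients, a test function of degree \<open>d\<close> kills them. What remains in the first column vanishes to
  order \<open>m - d\<close> up to terms of valuation below \<open>s\<close>, so its large entries extend over length at least
  \<open>m - d\<close>: otherwise one of them could be isolated and would dominate a vanishing sum
  (\<open>column_spread_of_vanishing\<close>).

  A section of the extended hull is the hull of lattice points only at special heights, and its extreme
  column is in general not integral. Its extreme face, however, lies on the face of the extended hull
  cut out by a supporting plane parallel to the columns. This face is spanned by generators for which
  the previous estimate holds at their own height. Heights, columns, lengths and widths are all
  combined linearly by convex combinations, so the estimate \<open>length of the face \<ge> m - width\<close> passes
  from the generators to every height (\<open>level_section_left_face\<close>).

  Applied to \<open>u\<close> and \<open>- u\<close> the estimate gives the two sides demanded by thickness in dimension 2. In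
  lower dimension it excludes points and, with Dirichlet's approximation theorem, irrational segments,
  and it bounds the length of rational ones (\<open>thick_of_faces_long\<close>). Membership in the tropical curve is
  the case of a vanishing sum without a strictly dominant term (\<open>no_dominant_term_of_sum_eq_0\<close>).
\<close>

section \<open>Binomial coefficients with integer upper index in a field of any characteristic\<close>

text \<open>
  In positive characteristic the quotient defining \<open>i choose k\<close> is not available, so the coefficient
  is read off from \<open>(1 + X)\<^sup>i\<close>. This is also the form in which Taylor coefficients present it.
\<close>

definition ibin :: "int \<Rightarrow> nat \<Rightarrow> 'a::field" where
  "ibin i k = fps_nth ((1 + fps_X) powi i) k"

text \<open>
  Power series do not form a division ring, but a single unit suffices for the laws of its powers.
\<close>

lemma unit_powi_Suc:
  fixes x :: "'a::{comm_ring_1,inverse}"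
  assumes "inverse x * x = 1"
  shows "x powi (n + 1) = x powi n * x"
proof (cases "n \<ge> 0")
  case True
  then show ?thesis by (simp add: power_int_def nat_add_distrib)
next
  case False
  define k where "k = nat (- n - 1)"
  have k: "nat (- n) = Suc k" "n + 1 = - int k" using False by (auto simp: k_def)
  have "x powi (n + 1) = inverse x ^ k"
    unfolding k(2) by (cases "k = 0") (auto simp: power_int_def)
  moreover have "x powi n = inverse x ^ k * inverse x"
    using False k by (simp add: power_int_def mult.commute)
  ultimately show ?thesis using assms by (simp add: mult.assoc)
qed

lemma unit_powi_add:
  fixes x :: "'a::{comm_ring_1,inverse}"
  assumes "inverse x * x = 1"
  shows "x powi (m + n) = x powi m * x powi n"
proof (induction n rule: int_induct[where k = 0])
  case (step1 i)
  then show ?case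
    using unit_powi_Suc[OF assms, of "m + i"] unit_powi_Suc[OF assms, of i]
    by (simp add: algebra_simps)
next
  case (step2 i)
  have inv: "y * x * inverse x = y" for y
    using assms by (simp add: mult.assoc mult.commute[of x])
  have "x powi (m + i) = x powi (m + (i - 1)) * x"
    using unit_powi_Suc[OF assms, of "m + (i - 1)"] by (simp add: algebra_simps)
  moreover have "x powi i = x powi (i - 1) * x"
    using unit_powi_Suc[OF assms, of "i - 1"] by simp
  ultimately have "x powi (m + (i - 1)) * x * inverse x = x powi m * x powi (i - 1) * x * inverse x"
    using step2 by (simp add: mult.assoc)
  then show ?case by (simp only: inv)
qed simp

lemma fps_shifted_X_unit:
  fixes c :: "'a::field"
  assumes "c \<noteq> 0"
  shows "inverse (fps_const c + fps_X) * (fps_const c + fps_X) = (1 :: 'a fps)"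
  using assms by (intro inverse_mult_eq_1) simp

lemma fps_one_plus_X_unit: "inverse (1 + fps_X) * (1 + fps_X) = (1 :: 'a::field fps)"
  using fps_shifted_X_unit[of 1] by simp

lemma ibin_vandermonde: "ibin (x + c) k = (\<Sum>r\<le>k. ibin x r * ibin c (k - r) :: 'a::field)"
  unfolding ibin_def unit_powi_add[OF fps_one_plus_X_unit, of x c] fps_mult_nth atLeast0AtMost
  by (rule refl)

lemma fps_shifted_X_powi_Suc_nth:
  fixes c :: "'a::field"
  assumes "c \<noteq> 0"
  shows "fps_nth ((fps_const c + fps_X) powi (i + 1)) (Suc k) =
    c * fps_nth ((fps_const c + fps_X) powi i) (Suc k) + fps_nth ((fps_const c + fps_X) powi i) k"
    and "fps_nth ((fps_const c + fps_X) powi (i + 1)) 0 = c * fps_nth ((fps_const c + fps_X) powi i) 0"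
  unfolding unit_powi_Suc[OF fps_shifted_X_unit[OF assms]]
  by (simp_all add: distrib_left)

lemma ibin_Suc_Suc: "ibin (i + 1) (Suc k) = (ibin i (Suc k) + ibin i k :: 'a::field)"
  using fps_shifted_X_powi_Suc_nth(1)[of "1 :: 'a" i k] by (simp add: ibin_def)

lemma ibin_0_left: "ibin 0 k = (if k = 0 then 1 else 0 :: 'a::field)"
  by (simp add: ibin_def)

lemma ibin_0_right [simp]: "ibin i 0 = (1 :: 'a::field)"
proof (induction i rule: int_induct[where k = 0])
  case (step1 i)
  then show ?case
    using fps_shifted_X_powi_Suc_nth(2)[of "1 :: 'a" i] by (simp add: ibin_def)
next
  case (step2 i)
  then show ?case
    using fps_shifted_X_powi_Suc_nth(2)[of "1 :: 'a" "i - 1"] by (simp add: ibin_def)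
qed (simp add: ibin_def)

lemma ibin_minus_one: "ibin (-1) k = ((-1) ^ k :: 'a::field)"
proof (induction k)
  case (Suc k)
  have "ibin (-1) (Suc k) + ibin (-1) k = (0 :: 'a)"
    using ibin_Suc_Suc[of "-1" k] by (simp add: ibin_0_left)
  then show ?case using Suc by (simp add: eq_neg_iff_add_eq_0)
qed simp

text \<open>
  With \<open>ibin_minus_one\<close> this makes \<open>ibin (x - k - 1) d\<close> an ideal cut-off function: it vanishes on
  the \<open>d\<close> consecutive integers after \<open>k\<close> and is a unit of the valuation ring at \<open>k\<close> itself, whatever
  the residue characteristic. The product of the linear factors would acquire the factor \<open>d!\<close>.
\<close>

lemma ibin_eq_0:
  assumes "0 \<le> i" "i < int k"
  shows "ibin i k = (0 :: 'a::field)"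
  using assms
proof (induction i arbitrary: k rule: int_ge_induct)
  case base
  then show ?case by (simp add: ibin_0_left)
next
  case (step i)
  then obtain l where "k = Suc l" by (cases k) auto
  with step show ?case by (simp add: ibin_Suc_Suc)
qed

text \<open>Rescaling \<open>X\<close> by the nonzero constant \<open>c\<close> reduces the expansion at \<open>c\<close> to the one at 1.\<close>

lemma fps_shifted_X_powi_nth:
  fixes c :: "'a::field"
  assumes c: "c \<noteq> 0"
  shows "c ^ k * fps_nth ((fps_const c + fps_X) powi i) k = c powi i * ibin i k"
proof (induction k arbitrary: i)
  case 0
  show ?case
  proof (induction i rule: int_induct[where k = 0])
    case (step1 i)
    then show ?case using c by (simp add: fps_shifted_X_powi_Suc_nth(2) power_int_add)
  next
    case (step2 i)
    then show ?case
      using c fps_shifted_X_powi_Suc_nth(2)[OF c, of "i - 1"]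
      by (simp add: power_int_diff field_simps)
  qed simp
next
  case (Suc k)
  let ?g = "\<lambda>i k. fps_nth ((fps_const c + fps_X) powi i) k"
  show ?case
  proof (induction i rule: int_induct[where k = 0])
    case base
    then show ?case by (simp add: ibin_0_left)
  next
    case (step1 i)
    have "c ^ Suc k * ?g (i + 1) (Suc k) = c * (c ^ Suc k * ?g i (Suc k)) + c * (c ^ k * ?g i k)"
      unfolding fps_shifted_X_powi_Suc_nth(1)[OF c] by (simp add: distrib_left mult.left_commute)
    also have "\<dots> = c powi (i + 1) * ibin (i + 1) (Suc k)"
      unfolding step1(2) Suc ibin_Suc_Suc using c by (simp add: power_int_add algebra_simps)
    finally show ?case .
  next
    case (step2 i)
    have "c ^ Suc k * ?g i (Suc k) = c * (c ^ Suc k * ?g (i - 1) (Suc k)) + c * (c ^ k * ?g (i - 1) k)"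
      using fps_shifted_X_powi_Suc_nth(1)[OF c, of "i - 1" k]
      by (simp add: distrib_left mult.left_commute)
    then have "c * (c ^ Suc k * ?g (i - 1) (Suc k)) =
        c powi i * ibin i (Suc k) - c * (c powi (i - 1) * ibin (i - 1) k)"
      unfolding step2(2) Suc by (simp only: add_diff_cancel_right')
    also have "\<dots> = c powi i * (ibin i (Suc k) - ibin (i - 1) k)"
      using c by (simp add: power_int_diff right_diff_distrib)
    also have "\<dots> = c * (c powi (i - 1) * ibin (i - 1) (Suc k))"
    proof -
      have "ibin i (Suc k) - ibin (i - 1) k = (ibin (i - 1) (Suc k) :: 'a)"
        using ibin_Suc_Suc[of "i - 1" k, where 'a = 'a] by (simp only: diff_add_cancel add_diff_cancel_right')
      moreover have "c powi i = c * c powi (i - 1)" using c by (simp add: power_int_diff)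
      ultimately show ?thesis by (simp only: mult.assoc)
    qed
    finally show ?case using c by simp
  qed
qed

section \<open>Newton expansions of binomials of linear forms\<close>

text \<open>
  The span of the products \<open>ibin i k * ibin j l\<close> with \<open>k + l < n\<close>: polynomial functions on the lattice
  of degree less than \<open>n\<close>, in a form that makes sense in every characteristic.
\<close>

inductive newton_lt :: "nat \<Rightarrow> (int \<Rightarrow> int \<Rightarrow> 'a::field) \<Rightarrow> bool" for n where
  zero: "newton_lt n (\<lambda>i j. 0)"
| monom: "k + l < n \<Longrightarrow> newton_lt n (\<lambda>i j. c * (ibin i k * ibin j l))"
| add: "newton_lt n f \<Longrightarrow> newton_lt n g \<Longrightarrow> newton_lt n (\<lambda>i j. f i j + g i j)"

lemma newton_lt_scale: "newton_lt n f \<Longrightarrow> newton_lt n (\<lambda>i j. c * f i j)"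
proof (induction rule: newton_lt.induct)
  case (monom k l c')
  then show ?case using newton_lt.monom[of k l n "c * c'"] by (simp add: mult.assoc)
qed (auto simp: distrib_left intro: newton_lt.zero newton_lt.add)

lemma newton_lt_sum:
  assumes "finite S" "\<And>x. x \<in> S \<Longrightarrow> newton_lt n (f x)"
  shows "newton_lt n (\<lambda>i j. \<Sum>x\<in>S. f x i j)"
  using assms by (induction rule: finite_induct) (auto intro: newton_lt.zero newton_lt.add)

lemma newton_lt_row_0: "newton_lt n f \<Longrightarrow> newton_lt n (\<lambda>i j. f 0 j)"
proof (induction rule: newton_lt.induct)
  case (monom k l c)
  then show ?case using newton_lt.monom[of 0 l n "c * ibin 0 k"]
    by (simp add: mult.assoc ibin_0_left del: mult_eq_0_iff)
qed (auto intro: newton_lt.zero newton_lt.add)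

text \<open>
  By Pascal's rule, summation raises the index of a binomial coefficient by one. The normalisation at
  0 makes the antidifference unique.
\<close>

lemma newton_lt_antidifference1:
  assumes "newton_lt n g"
  shows "\<exists>G. newton_lt (Suc n) G \<and> (\<forall>i j. G (i + 1) j - G i j = g i j) \<and> (\<forall>j. G 0 j = 0)"
  using assms
proof (induction rule: newton_lt.induct)
  case zero
  show ?case by (intro exI[of _ "\<lambda>i j. 0"]) (simp add: newton_lt.zero)
next
  case (monom k l c)
  then show ?case
    using newton_lt.monom[of "Suc k" l "Suc n" c]
    by (intro exI[of _ "\<lambda>i j. c * (ibin i (Suc k) * ibin j l)"])
      (simp add: ibin_Suc_Suc ibin_0_left distrib_left distrib_right)
next
  case (add f g)
  then obtain F G where
    "newton_lt (Suc n) F \<and> (\<forall>i j. F (i + 1) j - F i j = f i j) \<and> (\<forall>j. F 0 j = 0)"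
    "newton_lt (Suc n) G \<and> (\<forall>i j. G (i + 1) j - G i j = g i j) \<and> (\<forall>j. G 0 j = 0)" by blast
  then show ?case
    by (intro exI[of _ "\<lambda>i j. F i j + G i j"]) (auto simp: add_diff_add intro: newton_lt.add)
qed

lemma newton_lt_antidifference2:
  assumes "newton_lt n g"
  shows "\<exists>G. newton_lt (Suc n) G \<and> (\<forall>i j. G i (j + 1) - G i j = g i j) \<and> (\<forall>i. G i 0 = 0)"
  using assms
proof (induction rule: newton_lt.induct)
  case zero
  show ?case by (intro exI[of _ "\<lambda>i j. 0"]) (simp add: newton_lt.zero)
next
  case (monom k l c)
  then show ?case
    using newton_lt.monom[of k "Suc l" "Suc n" c]
    by (intro exI[of _ "\<lambda>i j. c * (ibin i k * ibin j (Suc l))"])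
      (simp add: ibin_Suc_Suc ibin_0_left distrib_left distrib_right)
next
  case (add f g)
  then obtain F G where
    "newton_lt (Suc n) F \<and> (\<forall>i j. F i (j + 1) - F i j = f i j) \<and> (\<forall>i. F i 0 = 0)"
    "newton_lt (Suc n) G \<and> (\<forall>i j. G i (j + 1) - G i j = g i j) \<and> (\<forall>i. G i 0 = 0)" by blast
  then show ?case
    by (intro exI[of _ "\<lambda>i j. F i j + G i j"]) (auto simp: add_diff_add intro: newton_lt.add)
qed

lemma int_fun_eqI:
  fixes f g :: "int \<Rightarrow> 'a::ab_group_add"
  assumes "f 0 = g 0" "\<And>i. f (i + 1) - f i = g (i + 1) - g i"
  shows "f i = g i"
proof (induction i rule: int_induct[where k = 0])
  case (step1 i)
  then show ?case using assms(2)[of i] by simp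
next
  case (step2 i)
  then show ?case using assms(2)[of "i - 1"] by simp
qed (fact assms(1))

text \<open>
  A function on the lattice is determined by its value at the origin and its two differences, so
  antidifferences of these differences recover it: first along the column \<open>i = 0\<close>, then along rows.
\<close>

lemma newton_lt_of_differences:
  fixes f :: "int \<Rightarrow> int \<Rightarrow> 'a::field"
  assumes "newton_lt n (\<lambda>i j. f (i + 1) j - f i j)" "newton_lt n (\<lambda>i j. f i (j + 1) - f i j)"
  shows "newton_lt (Suc n) f"
proof -
  obtain F where F: "newton_lt (Suc n) F" "\<And>i j. F (i + 1) j - F i j = f (i + 1) j - f i j"
    "\<And>j. F 0 j = 0"
    using newton_lt_antidifference1[OF assms(1)] by blast
  obtain G where G: "newton_lt (Suc n) G" "\<And>i j. G i (j + 1) - G i j = f i (j + 1) - f i j"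
    "\<And>i. G i 0 = 0"
    using newton_lt_antidifference2[OF assms(2)] by blast
  have "f = (\<lambda>i j. F i j + (G 0 j + f 0 0 * (ibin i 0 * ibin j 0)))"
  proof (intro ext)
    fix i j
    have "f 0 j = G 0 j + f 0 0"
      using int_fun_eqI[of "\<lambda>j. f 0 j" "\<lambda>j. G 0 j + f 0 0" j] by (simp add: G)
    moreover have "f i j = F i j + f 0 j"
      using int_fun_eqI[of "\<lambda>i. f i j" "\<lambda>i. F i j + f 0 j" i] by (simp add: F)
    ultimately show "f i j = F i j + (G 0 j + f 0 0 * (ibin i 0 * ibin j 0))" by simp
  qed
  moreover have "newton_lt (Suc n) (\<lambda>i j. F i j + (G 0 j + f 0 0 * (ibin i 0 * ibin j 0)))"
    by (intro newton_lt.add F newton_lt_row_0 G newton_lt.monom) simp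
  ultimately show ?thesis by (rule ssubst[where P = "newton_lt (Suc n)"])
qed

text \<open>
  The degree filtration does not depend on the choice of lattice coordinates. By Vandermonde's
  identity, a translation difference of such a product is a combination of products with a smaller
  index sum, so induction on the degree applies to both differences.
\<close>

lemma newton_lt_ibin_linear:
  fixes u1 u2 v1 v2 s t :: int
  assumes "k + l < n"
  shows "newton_lt n
    (\<lambda>i j. ibin (u1 * i + u2 * j + s) k * ibin (v1 * i + v2 * j + t) l :: 'a::field)"
  using assms
proof (induction n arbitrary: k l)
  case (Suc n)
  define f :: "nat \<Rightarrow> nat \<Rightarrow> int \<Rightarrow> int \<Rightarrow> 'a" where
    "f = (\<lambda>k l i j. ibin (u1 * i + u2 * j + s) k * ibin (v1 * i + v2 * j + t) l)"
  have IH: "newton_lt n (f r q)" if "r + q < n" for r q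
    unfolding f_def using Suc.IH that .
  define R where "R = {..k} \<times> {..l} - {(k, l)}"
  have diff: "newton_lt n (\<lambda>i j. f k l (i + x) (j + y) - f k l i j)" for x y
  proof -
    define w where "w = (\<lambda>(r, q). ibin (u1 * x + u2 * y) (k - r) * ibin (v1 * x + v2 * y) (l - q) :: 'a)"
    have "(\<lambda>i j. f k l (i + x) (j + y) - f k l i j) = (\<lambda>i j. \<Sum>z\<in>R. w z * f (fst z) (snd z) i j)"
    proof (intro ext)
      fix i j
      have "f k l (i + x) (j + y) =
          ibin ((u1 * i + u2 * j + s) + (u1 * x + u2 * y)) k *
          ibin ((v1 * i + v2 * j + t) + (v1 * x + v2 * y)) l"
        by (simp add: f_def algebra_simps)
      also have "\<dots> = (\<Sum>z\<in>{..k} \<times> {..l}. w z * f (fst z) (snd z) i j)"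
        unfolding ibin_vandermonde[of "u1 * i + u2 * j + s"] ibin_vandermonde[of "v1 * i + v2 * j + t"]
          sum_product sum.cartesian_product
        by (rule sum.cong) (auto simp: w_def f_def)
      also have "\<dots> = w (k, l) * f k l i j + (\<Sum>z\<in>R. w z * f (fst z) (snd z) i j)"
        unfolding R_def by (subst sum.remove[of _ "(k, l)"]) auto
      finally show "f k l (i + x) (j + y) - f k l i j = (\<Sum>z\<in>R. w z * f (fst z) (snd z) i j)"
        by (simp add: w_def ibin_0_right)
    qed
    moreover have "newton_lt n (\<lambda>i j. \<Sum>z\<in>R. w z * f (fst z) (snd z) i j)"
    proof (intro newton_lt_sum newton_lt_scale IH)
      show "finite R" by (simp add: R_def)
      fix z assume "z \<in> R"
      then show "fst z + snd z < n" using Suc.prems by (cases z) (auto simp: R_def)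
    qed
    ultimately show ?thesis by (rule ssubst[where P = "newton_lt n"])
  qed
  have "newton_lt (Suc n) (f k l)"
    using diff[of 1 0] diff[of 0 1] by (intro newton_lt_of_differences) simp_all
  then show ?case unfolding f_def .
qed simp

section \<open>Valuations of vanishing sums\<close>

context valuation_field
begin

lemma val_finite: "x \<noteq> 0 \<Longrightarrow> val x = ereal (real_of_ereal (val x))"
  using val_neq_PInf[of x] val_eq_MInf_iff[of x] by (cases "val x") auto

lemma val_1: "val 1 = 0"
  using val_mult[of 1 1] val_finite[of 1] by (cases "val 1") auto

lemma val_minus: "val (- x) = val x"
proof -
  have "val (-1) = 0"
    using val_mult[of "-1" "-1"] val_finite[of "-1"] val_1 by (cases "val (-1)") (auto simp: zero_ereal_def)
  then show ?thesis using val_mult[of "-1" x] by simp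
qed

lemma val_sum_less:
  assumes "finite S" "-\<infinity> < r" "\<And>x. x \<in> S \<Longrightarrow> val (g x) < r"
  shows "val (sum g S) < r"
  using assms(1,3)
proof (induction rule: finite_induct)
  case empty
  have "val 0 = -\<infinity>" by (simp add: val_eq_MInf_iff)
  then show ?case using assms(2) by simp
next
  case (insert x S)
  then have "max (val (g x)) (val (sum g S)) < r" by simp
  then show ?case using insert val_add[of "g x" "sum g S"] by (simp add: order_le_less_trans)
qed

text \<open>
  The terms other than a strictly dominant one would have a sum of smaller valuation, which cannot
  cancel it.
\<close>

lemma no_dominant_term_of_sum_eq_0:
  assumes "finite S" "sum g S = 0" "e \<in> S" "g e \<noteq> 0"
  shows "\<exists>x\<in>S - {e}. val (g e) \<le> val (g x)"
proof (rule ccontr)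
  assume "\<not> ?thesis"
  then have "val (sum g (S - {e})) < val (g e)"
    using assms(1,4) val_eq_MInf_iff[of "g e"] by (intro val_sum_less) (auto simp: not_le)
  moreover have "sum g (S - {e}) = - g e"
    using assms by (simp add: sum_diff1)
  ultimately show False by (simp add: val_minus)
qed

text \<open>
  Binomial coefficients are integers, hence lie in the valuation ring. Pascal's rule, used in both
  directions, gives this without passing through the integers.
\<close>

lemma val_ibin_le_0: "val (ibin i k) \<le> 0"
proof (induction k arbitrary: i)
  case 0
  then show ?case by (simp add: val_1)
next
  case (Suc k)
  show ?case
  proof (induction i rule: int_induct[where k = 0])
    case base
    have "val 0 = -\<infinity>" by (simp add: val_eq_MInf_iff)
    then show ?case by (simp add: ibin_0_left)
  next
    case (step1 i)
    then show ?case
      using Suc[of i] val_add[of "ibin i (Suc k)" "ibin i k"]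
      unfolding ibin_Suc_Suc by (meson max.boundedI order_trans)
  next
    case (step2 i)
    have "ibin (i - 1) (Suc k) = (ibin i (Suc k) + - ibin (i - 1) k :: 'k)"
      using ibin_Suc_Suc[of "i - 1" k, where 'a = 'k]
      by (simp only: diff_add_cancel add_diff_cancel_right' flip: diff_conv_add_uminus)
    then show ?case
      using step2 Suc[of "i - 1"] val_add[of "ibin i (Suc k)" "- ibin (i - 1) k"]
      unfolding val_minus by (metis max.boundedI order_trans)
  qed
qed

lemma val_powi:
  assumes "x \<noteq> 0"
  shows "val (x powi n) = ereal (of_int n * real_of_ereal (val x))"
proof (induction n rule: int_induct[where k = 0])
  case base
  then show ?case by (simp add: val_1)
next
  case (step1 i)
  have "val (x powi (i + 1)) = val (x powi i) + val x"
    using assms by (simp add: power_int_add_1 val_mult)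
  then show ?case
    using step1 val_finite[OF assms] by (metis distrib_right mult_1 of_int_1 of_int_add plus_ereal.simps(1))
next
  case (step2 i)
  have "val (x powi i) = val (x powi (i - 1)) + val x"
    using assms by (simp add: power_int_minus_mult flip: val_mult)
  then show ?case
    using step2 val_finite[OF assms] val_finite[of "x powi (i - 1)"] assms
    by (cases "val (x powi (i - 1))"; cases "val x") (auto simp: algebra_simps)
qed

end

section \<open>Vanishing to high order forces long columns of large coefficients\<close>

text \<open>
  A pair \<open>u, v\<close> with determinant 1 gives new lattice coordinates \<open>idot u\<close>, \<open>idot v\<close>; the arguments
  below speak of columns, the level sets of \<open>idot u\<close>.
\<close>

definition idot :: "int \<times> int \<Rightarrow> int \<times> int \<Rightarrow> int" where
  "idot u e = fst u * fst e + snd u * snd e"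

definition idet :: "int \<times> int \<Rightarrow> int \<times> int \<Rightarrow> int" where
  "idet u v = fst u * snd v - snd u * fst v"

lemma idot_unimodular_inj:
  assumes "idet u v = 1" "idot u e = idot u f" "idot v e = idot v f"
  shows "e = f"
proof -
  have 1: "idet u v * fst w = snd v * idot u w - snd u * idot v w" for w
    by (simp add: idot_def idet_def algebra_simps)
  have 2: "idet u v * snd w = fst u * idot v w - fst v * idot u w" for w
    by (simp add: idot_def idet_def algebra_simps)
  show ?thesis using 1[of e] 1[of f] 2[of e] 2[of f] assms by (simp add: prod_eq_iff)
qed

text \<open>
  The only property of the heights \<open>c\<close> that the geometry uses. Consider the lattice points of height at
  least \<open>s\<close>, and suppose that \<open>e\<close> is one of them with no such point in an earlier column. Then the
  points of height at least \<open>s\<close> in the column of \<open>e\<close> extend over a length that, together with the width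
  from this column to the column of some such point \<open>e3\<close>, amounts to at least \<open>m\<close>. All real \<open>s\<close>
  have to be admitted, not only values of \<open>c\<close>.
\<close>

definition column_spread :: "nat \<Rightarrow> (int \<times> int) set \<Rightarrow> (int \<times> int \<Rightarrow> real) \<Rightarrow> bool" where
  "column_spread m A c \<longleftrightarrow>
    (\<forall>u v e s. idet u v = 1 \<longrightarrow> e \<in> A \<longrightarrow> s \<le> c e \<longrightarrow> (\<forall>f\<in>A. idot u f < idot u e \<longrightarrow> c f < s) \<longrightarrow>
      (\<exists>e1\<in>A. \<exists>e2\<in>A. \<exists>e3\<in>A. s \<le> c e1 \<and> s \<le> c e2 \<and> s \<le> c e3 \<and>
        idot u e1 = idot u e \<and> idot u e2 = idot u e \<and>
        int m - (idot u e3 - idot u e) \<le> idot v e2 - idot v e1))"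

lemma ex_maximizer:
  fixes g :: "'a \<Rightarrow> 'b::linorder"
  assumes "finite S" "S \<noteq> {}"
  shows "\<exists>x\<in>S. \<forall>y\<in>S. g y \<le> g x"
proof -
  have "Max (g ` S) \<in> g ` S" using assms by simp
  then obtain x where "x \<in> S" "Max (g ` S) = g x" by blast
  then show ?thesis using assms(1) by (metis Max_ge finite_imageI imageI)
qed

lemma newton_lt_annihilated:
  fixes b :: "int \<Rightarrow> int \<Rightarrow> 'a::field"
  assumes "newton_lt m f"
    and "\<And>k l. k + l < m \<Longrightarrow> (\<Sum>(i, j)\<in>A. b i j * (ibin i k * ibin j l)) = 0"
  shows "(\<Sum>(i, j)\<in>A. b i j * f i j) = 0"
  using assms(1)
proof (induction rule: newton_lt.induct)
  case (monom k l c)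
  have "(\<Sum>(i, j)\<in>A. b i j * (c * (ibin i k * ibin j l))) =
      c * (\<Sum>(i, j)\<in>A. b i j * (ibin i k * ibin j l))"
    by (simp add: sum_distrib_left case_prod_unfold mult_ac)
  then show ?case using assms(2)[OF monom] by simp
next
  case (add f g)
  then show ?case by (simp add: case_prod_unfold distrib_left sum.distrib)
qed simp

text \<open>
  If the column were too short, a product of two cut-off functions of total degree below \<open>m\<close> would
  kill the later columns of large coefficients and all of the column of \<open>e\<close> but its lowest entry. The
  coefficients below height \<open>s\<close> stay below it, so this entry would dominate a vanishing sum.
\<close>

lemma (in valuation_field) column_spread_of_vanishing:
  fixes b :: "int \<Rightarrow> int \<Rightarrow> 'k"
  assumes fin: "finite A"
    and val_b: "\<And>i j. (i, j) \<in> A \<Longrightarrow> val (b i j) = ereal (c (i, j))"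
    and vanish: "\<And>k l. k + l < m \<Longrightarrow> (\<Sum>(i, j)\<in>A. b i j * (ibin i k * ibin j l)) = 0"
  shows "column_spread m A c"
  unfolding column_spread_def
proof (intro allI impI)
  fix u v e s
  assume det: "idet u v = 1" and e: "e \<in> A" "s \<le> c e"
    and left: "\<forall>f\<in>A. idot u f < idot u e \<longrightarrow> c f < s"
  define H where "H = {f \<in> A. s \<le> c f}"
  define J where "J = {f \<in> H. idot u f = idot u e}"
  have fin_H: "finite H" "finite J" and eH: "e \<in> H" "e \<in> J"
    using fin e by (auto simp: H_def J_def)
  have left_H: "idot u e \<le> idot u f" if "f \<in> H" for f
    using left that by (force simp: H_def)
  obtain e3 where e3: "e3 \<in> H" "\<And>f. f \<in> H \<Longrightarrow> idot u f \<le> idot u e3"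
    using ex_maximizer[of H "idot u"] fin_H eH by blast
  obtain e1 where e1: "e1 \<in> J" "\<And>f. f \<in> J \<Longrightarrow> idot v e1 \<le> idot v f"
    using ex_maximizer[of J "\<lambda>f. - idot v f"] fin_H eH by (metis empty_iff neg_le_iff_le)
  obtain e2 where e2: "e2 \<in> J" "\<And>f. f \<in> J \<Longrightarrow> idot v f \<le> idot v e2"
    using ex_maximizer[of J "idot v"] fin_H eH by blast
  have "int m - (idot u e3 - idot u e) \<le> idot v e2 - idot v e1"
  proof (rule ccontr)
    assume "\<not> ?thesis"
    then have short: "idot v e2 - idot v e1 < int m - (idot u e3 - idot u e)" by simp
    \<comment> \<open>\<open>d\<close> columns have to be killed, which leaves degree \<open>n\<close> for the column of \<open>e\<close>.\<close>
    define d where "d = nat (idot u e3 - idot u e)"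
    have d: "int d = idot u e3 - idot u e" using e3(2)[OF eH(1)] by (simp add: d_def)
    define n where "n = m - d - 1"
    have nd: "int n = int m - int d - 1" "d + n < m"
      using short e2(2)[OF e1(1)] d by (auto simp: n_def)
    define f :: "int \<times> int \<Rightarrow> 'k" where
      "f = (\<lambda>w. ibin (idot u w - idot u e - 1) d * ibin (idot v w - idot v e1 - 1) n)"
    define g where "g = (\<lambda>(i, j). b i j * f (i, j))"
    have sum0: "sum g A = 0"
      using newton_lt_annihilated[OF newton_lt_ibin_linear[OF nd(2), of "fst u" "snd u" "- idot u e - 1"
            "fst v" "snd v" "- idot v e1 - 1"] vanish]
      by (simp add: g_def f_def idot_def algebra_simps)
    have e1A: "e1 \<in> A" "s \<le> c e1" "idot u e1 = idot u e" using e1 by (auto simp: J_def H_def)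
    have f_e1: "f e1 = (-1) ^ (d + n)"
      using ibin_minus_one[of d, where 'a = 'k] ibin_minus_one[of n, where 'a = 'k]
      by (simp add: f_def e1A power_add)
    then have g_e1: "g e1 = (-1) ^ (d + n) * b (fst e1) (snd e1)"
      by (simp add: g_def case_prod_unfold)
    then have val_g_e1: "val (g e1) = ereal (c e1)"
      using val_b[of "fst e1" "snd e1"] e1A by (cases "even (d + n)") (auto simp: val_minus)
    then have "g e1 \<noteq> 0" using val_eq_MInf_iff[of "g e1"] by auto
    then obtain x where x: "x \<in> A" "x \<noteq> e1" "val (g e1) \<le> val (g x)"
      using no_dominant_term_of_sum_eq_0[OF fin sum0 e1A(1)] by blast
    then have "g x \<noteq> 0" using val_g_e1 val_eq_MInf_iff[of "g x"] by auto
    then have fx: "f x \<noteq> 0" by (auto simp: g_def case_prod_unfold)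
    have "val (f x) \<le> 0"
      unfolding f_def val_mult using val_ibin_le_0 by (simp add: add_nonpos_nonpos)
    then have "val (g x) \<le> ereal (c x)"
      using val_b[of "fst x" "snd x"] x(1) add_mono[of "ereal (c x)" "ereal (c x)" "val (f x)" 0]
      by (simp add: g_def case_prod_unfold val_mult)
    then have xH: "x \<in> H"
      using x val_g_e1 e1A(2) unfolding H_def by (metis (mono_tags, lifting) ereal_less_eq(3) mem_Collect_eq order_trans)
    \<comment> \<open>A later column would lie among the \<open>d\<close> zeros of the first cut-off function.\<close>
    have xJ: "idot u x = idot u e"
    proof (rule ccontr)
      assume "idot u x \<noteq> idot u e"
      then have "ibin (idot u x - idot u e - 1) d = (0 :: 'k)"
        using left_H[OF xH] e3(2)[OF xH] d by (intro ibin_eq_0) auto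
      then show False using fx by (simp add: f_def)
    qed
    have "idot v x \<noteq> idot v e1"
      using idot_unimodular_inj[OF det, of x e1] x(2) xJ e1A by auto
    moreover have "x \<in> J" using xJ xH by (simp add: J_def)
    ultimately have "ibin (idot v x - idot v e1 - 1) n = (0 :: 'k)"
      using e1(2)[of x] e2(2)[of x] short d nd by (intro ibin_eq_0) auto
    then show False using fx by (simp add: f_def)
  qed
  then show "\<exists>e1\<in>A. \<exists>e2\<in>A. \<exists>e3\<in>A. s \<le> c e1 \<and> s \<le> c e2 \<and> s \<le> c e3 \<and>
        idot u e1 = idot u e \<and> idot u e2 = idot u e \<and>
        int m - (idot u e3 - idot u e) \<le> idot v e2 - idot v e1"
    using e1(1) e2(1) e3(1) unfolding J_def H_def by blast
qed

section \<open>Extremal faces of the sections of a subgraph hull\<close>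

text \<open>
  The hull of the region below finitely many heights, and its horizontal sections, for an arbitrary
  height function: in this part no valuation is involved.
\<close>

definition subgraph_hull :: "(int \<times> int) set \<Rightarrow> (int \<times> int \<Rightarrow> real) \<Rightarrow> (real \<times> real \<times> real) set" where
  "subgraph_hull A c = convex hull {(of_int i, of_int j, s) | i j s. (i, j) \<in> A \<and> s \<le> c (i, j)}"

definition level_section :: "(int \<times> int) set \<Rightarrow> (int \<times> int \<Rightarrow> real) \<Rightarrow> real \<Rightarrow> (real \<times> real) set" where
  "level_section A c \<mu> = {(x, y). (x, y, \<mu>) \<in> subgraph_hull A c}"

definition base :: "real \<times> real \<times> real \<Rightarrow> real \<times> real" where
  "base p = (fst p, fst (snd p))"

definition height :: "real \<times> real \<times> real \<Rightarrow> real" where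
  "height p = snd (snd p)"

lemma base_comb [simp]: "base (a *\<^sub>R p + b *\<^sub>R q) = a *\<^sub>R base p + b *\<^sub>R base q"
  and height_comb [simp]: "height (a *\<^sub>R p + b *\<^sub>R q) = a * height p + b * height q"
  by (simp_all add: base_def height_def)

lemma in_level_section: "z \<in> level_section A c \<mu> \<longleftrightarrow> (\<exists>p\<in>subgraph_hull A c. base p = z \<and> height p = \<mu>)"
  by (cases z) (force simp: level_section_def base_def height_def)

lemma subgraph_hull_generator:
  assumes "e \<in> A" "s \<le> c e"
  shows "\<exists>p\<in>subgraph_hull A c. base p = real_vec e \<and> height p = s"
proof (intro bexI conjI)
  show "(of_int (fst e), of_int (snd e), s) \<in> subgraph_hull A c"
    unfolding subgraph_hull_def using assms by (intro hull_inc) (cases e, auto)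
qed (simp_all add: base_def height_def real_vec_def)

lemma level_section_generator: "e \<in> A \<Longrightarrow> s \<le> c e \<Longrightarrow> real_vec e \<in> level_section A c s"
  by (simp add: in_level_section subgraph_hull_generator)

lemma convex_subgraph_hull: "convex (subgraph_hull A c)"
  by (simp add: subgraph_hull_def)

lemma level_section_comb:
  assumes "z \<in> level_section A c s" "w \<in> level_section A c t" "0 \<le> a" "0 \<le> b" "a + b = 1"
  shows "a *\<^sub>R z + b *\<^sub>R w \<in> level_section A c (a * s + b * t)"
proof -
  obtain p q where "p \<in> subgraph_hull A c" "base p = z" "height p = s"
    "q \<in> subgraph_hull A c" "base q = w" "height q = t"
    using assms(1,2) unfolding in_level_section by blast
  then show ?thesis
    unfolding in_level_section using convexD[OF convex_subgraph_hull _ _ assms(3,4,5)]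
    by (intro bexI[of _ "a *\<^sub>R p + b *\<^sub>R q"]) auto
qed

lemma convex_level_section: "convex (level_section A c \<mu>)"
proof (rule convexI)
  fix z w :: "real \<times> real" and a b :: real
  assume *: "z \<in> level_section A c \<mu>" "w \<in> level_section A c \<mu>" "0 \<le> a" "0 \<le> b" "a + b = 1"
  have "a * \<mu> + b * \<mu> = \<mu>" using *(5) by (simp flip: distrib_right)
  then show "a *\<^sub>R z + b *\<^sub>R w \<in> level_section A c \<mu>" using level_section_comb[OF *] by simp
qed

text \<open>
  The hull is unbounded below, but it consists of the points below the compact hull of the tops
  \<open>(i, j, c (i, j))\<close>. Hence the section is the projection of the part of the latter at height at
  least \<open>\<mu>\<close>.
\<close>

lemma compact_level_section:
  assumes "finite A"
  shows "compact (level_section A c \<mu>)"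
proof -
  define lift where "lift = (\<lambda>e. (of_int (fst e), of_int (snd e), c e) :: real \<times> real \<times> real)"
  define top where "top = convex hull (lift ` A)"
  have down: "top \<subseteq> {q. q - (0, 0, t) \<in> subgraph_hull A c}" if "0 \<le> t" for t
    unfolding top_def
  proof (rule hull_minimal)
    show "lift ` A \<subseteq> {q. q - (0, 0, t) \<in> subgraph_hull A c}"
      unfolding subgraph_hull_def lift_def using that by (auto intro!: hull_inc)
    show "convex {q. q - (0, 0, t) \<in> subgraph_hull A c}"
    proof (rule convexI)
      fix p q :: "real \<times> real \<times> real" and a b :: real
      assume *: "p \<in> {q. q - (0, 0, t) \<in> subgraph_hull A c}" "q \<in> {q. q - (0, 0, t) \<in> subgraph_hull A c}"
        "0 \<le> a" "0 \<le> b" "a + b = 1"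
      have "a * t + b * t = t" using *(5) by (simp flip: distrib_right)
      then have "a *\<^sub>R (p - (0, 0, t)) + b *\<^sub>R (q - (0, 0, t)) = a *\<^sub>R p + b *\<^sub>R q - (0, 0, t)"
        by (cases p, cases q) (simp add: right_diff_distrib algebra_simps)
      moreover have "a *\<^sub>R (p - (0, 0, t)) + b *\<^sub>R (q - (0, 0, t)) \<in> subgraph_hull A c"
        using convexD[OF convex_subgraph_hull _ _ *(3,4,5)] *(1,2) by blast
      ultimately show "a *\<^sub>R p + b *\<^sub>R q \<in> {q. q - (0, 0, t) \<in> subgraph_hull A c}"
        by (simp only: mem_Collect_eq)
    qed
  qed
  have up: "subgraph_hull A c \<subseteq> {p. \<exists>q\<in>top. base q = base p \<and> height p \<le> height q}"
    unfolding subgraph_hull_def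
  proof (rule hull_minimal)
    show "{(of_int i, of_int j, s) | i j s. (i, j) \<in> A \<and> s \<le> c (i, j)}
        \<subseteq> {p. \<exists>q\<in>top. base q = base p \<and> height p \<le> height q}"
    proof clarify
      fix i j s assume *: "(i, j) \<in> A" "s \<le> c (i, j)"
      then have "lift (i, j) \<in> top" unfolding top_def by (intro hull_inc) auto
      then show "\<exists>q\<in>top. base q = base (of_int i, of_int j, s) \<and> height (of_int i, of_int j, s) \<le> height q"
        by (rule bexI[rotated]) (use * in \<open>auto simp: lift_def base_def height_def\<close>)
    qed
    show "convex {p. \<exists>q\<in>top. base q = base p \<and> height p \<le> height q}"
    proof (rule convexI)
      fix p q :: "real \<times> real \<times> real" and a b :: real
      assume *: "p \<in> {p. \<exists>q\<in>top. base q = base p \<and> height p \<le> height q}"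
        "q \<in> {p. \<exists>q\<in>top. base q = base p \<and> height p \<le> height q}"
        "0 \<le> a" "0 \<le> b" "a + b = 1"
      then obtain p' q' where p': "p' \<in> top" "base p' = base p" "height p \<le> height p'"
        and q': "q' \<in> top" "base q' = base q" "height q \<le> height q'" by blast
      have "a *\<^sub>R p' + b *\<^sub>R q' \<in> top"
        using convexD[OF convex_convex_hull _ _ *(3-5)] p'(1) q'(1) unfolding top_def by blast
      moreover have "a * height p + b * height q \<le> a * height p' + b * height q'"
        using p'(3) q'(3) *(3,4) by (intro add_mono mult_left_mono)
      ultimately show "a *\<^sub>R p + b *\<^sub>R q \<in> {p. \<exists>q\<in>top. base q = base p \<and> height p \<le> height q}"
        using p'(2) q'(2) by (intro CollectI bexI[of _ "a *\<^sub>R p' + b *\<^sub>R q'"]) simp_all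
    qed
  qed
  have "level_section A c \<mu> = base ` (top \<inter> {q. \<mu> \<le> height q})"
  proof (intro equalityI subsetI)
    fix z assume "z \<in> level_section A c \<mu>"
    then obtain p where p: "p \<in> subgraph_hull A c" "base p = z" "height p = \<mu>"
      unfolding in_level_section by blast
    obtain q where "q \<in> top" "base q = z" "\<mu> \<le> height q"
      using subsetD[OF up p(1)] p(2,3) by auto
    then show "z \<in> base ` (top \<inter> {q. \<mu> \<le> height q})" by auto
  next
    fix z assume "z \<in> base ` (top \<inter> {q. \<mu> \<le> height q})"
    then obtain q where q: "q \<in> top" "\<mu> \<le> height q" "z = base q" by blast
    then have "q - (0, 0, height q - \<mu>) \<in> subgraph_hull A c" using down[of "height q - \<mu>"] by auto
    then show "z \<in> level_section A c \<mu>"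
      unfolding in_level_section
      by (rule bexI[rotated]) (simp add: q base_def height_def)
  qed
  moreover have "compact (base ` (top \<inter> {q. \<mu> \<le> height q}))"
  proof (rule compact_continuous_image)
    show "continuous_on (top \<inter> {q. \<mu> \<le> height q}) base"
      unfolding base_def by (intro continuous_intros)
    have "closed {q. \<mu> \<le> height q}"
      unfolding height_def by (intro closed_Collect_le continuous_intros)
    moreover have "compact top"
      unfolding top_def using assms by (simp add: finite_imp_compact_convex_hull)
    ultimately show "compact (top \<inter> {q. \<mu> \<le> height q})" by (rule compact_Int_closed[rotated])
  qed
  ultimately show ?thesis by simp
qed

lemma inner_real_vec: "real_vec u \<bullet> real_vec e = of_int (idot u e)"
  by (simp add: real_vec_def idot_def)

text \<open>
  Seen along the columns, the hull is a planar region whose section at height \<open>\<mu>\<close> lies to the right of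
  \<open>\<alpha>\<close>. A line through \<open>(\<alpha>, \<mu>)\<close> supporting it on the left exists by separation, but this line could be
  horizontal when \<open>\<mu>\<close> is the maximal height. Describing the line by its inverse slope \<open>\<sigma>\<close> excludes this.
  The least \<open>\<sigma> \<ge> 0\<close> compatible with the points below height \<open>\<mu>\<close> works: the points above height
  \<open>\<mu>\<close> respect it, because the segment from a point above to a point below crosses the section.
\<close>

lemma supporting_slope:
  assumes fin: "finite A"
    and min: "\<And>z. z \<in> level_section A c \<mu> \<Longrightarrow> \<alpha> \<le> real_vec u \<bullet> z"
  obtains \<sigma> where "0 \<le> \<sigma>" "\<And>e. e \<in> A \<Longrightarrow> \<sigma> * (c e - \<mu>) \<le> of_int (idot u e) - \<alpha>"
proof -
  define X where "X = (\<lambda>e. real_of_int (idot u e))"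
  define Q where "Q = insert 0 ((\<lambda>e. (\<alpha> - X e) / (\<mu> - c e)) ` {e \<in> A. c e < \<mu>})"
  define \<sigma> where "\<sigma> = Max Q"
  have finQ: "finite Q" using fin by (simp add: Q_def)
  have \<sigma>Q: "\<sigma> \<in> Q" unfolding \<sigma>_def by (rule Max_in) (use finQ in \<open>auto simp: Q_def\<close>)
  have \<sigma>_ge: "q \<le> \<sigma>" if "q \<in> Q" for q using that finQ by (simp add: \<sigma>_def)
  have above: "\<alpha> \<le> X e" if "e \<in> A" "\<mu> \<le> c e" for e
    using min[OF level_section_generator[of e A \<mu> c, OF that]] by (simp add: X_def inner_real_vec)
  have cross: "(\<alpha> - X f) / (\<mu> - c f) * (c e - \<mu>) \<le> X e - \<alpha>"
    if ef: "e \<in> A" "f \<in> A" "c f < \<mu>" "\<mu> < c e" for e f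
  proof -
    define a b where "a = (\<mu> - c f) / (c e - c f)" and "b = (c e - \<mu>) / (c e - c f)"
    have ab: "0 \<le> a" "0 \<le> b" "a + b = 1" "a * c e + b * c f = \<mu>"
      using ef by (auto simp: a_def b_def divide_simps) (auto simp: algebra_simps)
    have "a *\<^sub>R real_vec e + b *\<^sub>R real_vec f \<in> level_section A c \<mu>"
      using level_section_comb[OF level_section_generator[of e A "c e" c] level_section_generator[of f A "c f" c] ab(1,2,3)]
        ef ab(4) by simp
    from min[OF this] have "\<alpha> \<le> a * X e + b * X f"
      by (simp add: inner_add_right inner_real_vec X_def)
    then have "\<alpha> * (c e - c f) \<le> (a * X e + b * X f) * (c e - c f)"
      using ef by (intro mult_right_mono) auto
    also have "\<dots> = (a * (c e - c f)) * X e + (b * (c e - c f)) * X f"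
      by (simp add: algebra_simps)
    also have "\<dots> = (\<mu> - c f) * X e + (c e - \<mu>) * X f"
      using ef by (simp add: a_def b_def)
    finally have "(\<alpha> - X f) * (c e - \<mu>) \<le> (X e - \<alpha>) * (\<mu> - c f)"
      by (simp add: algebra_simps)
    then show ?thesis using ef by (simp add: pos_divide_le_eq)
  qed
  show thesis
  proof (rule that[of \<sigma>])
    show "0 \<le> \<sigma>" using \<sigma>_ge[of 0] by (simp add: Q_def)
    fix e assume e: "e \<in> A"
    consider "c e < \<mu>" | "c e = \<mu>" | "\<mu> < c e" by linarith
    then have "\<sigma> * (c e - \<mu>) \<le> X e - \<alpha>"
    proof cases
      case 1
      then have "(\<alpha> - X e) / (\<mu> - c e) \<le> \<sigma>" using e by (intro \<sigma>_ge) (auto simp: Q_def)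
      then show ?thesis using 1 by (simp add: field_simps)
    next
      case 2
      then show ?thesis using above[OF e] by simp
    next
      case 3
      consider "\<sigma> = 0" | f where "f \<in> A" "c f < \<mu>" "\<sigma> = (\<alpha> - X f) / (\<mu> - c f)"
        using \<sigma>Q by (auto simp: Q_def)
      then show ?thesis using above[OF e] cross[OF e] 3 by cases auto
    qed
    then show "\<sigma> * (c e - \<mu>) \<le> of_int (idot u e) - \<alpha>" by (simp add: X_def)
  qed
qed

text \<open>
  The passage from lattice columns to real sections. Let \<open>\<phi> \<ge> 0\<close> be the supporting half-space of the
  previous lemma. A generator of the hull with \<open>\<phi> = 0\<close> has no points of its height in earlier columns,
  so \<open>column_spread\<close> provides \<open>z1, z2, z3\<close> at this height. The existence of such a triple is
  stable under convex combinations as long as heights and columns are combined in the same way: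
  lengths and widths then combine linearly. Thus the set \<open>K\<close> of points with \<open>\<phi> > 0\<close>, or with \<open>\<phi> = 0\<close>
  and a triple, is convex and contains the whole hull, in particular the point \<open>z0\<close> at height
  \<open>\<mu>\<close>. The interpolation absorbs the concavity of the right end of the section as a function of the
  height.
\<close>

lemma level_section_left_face:
  assumes fin: "finite A" and spread: "column_spread m A c" and det: "idet u v = 1"
    and z0: "z0 \<in> level_section A c \<mu>"
    and min: "\<And>z. z \<in> level_section A c \<mu> \<Longrightarrow> real_vec u \<bullet> z0 \<le> real_vec u \<bullet> z"
  shows "\<exists>z1\<in>level_section A c \<mu>. \<exists>z2\<in>level_section A c \<mu>. \<exists>z3\<in>level_section A c \<mu>.
    real_vec u \<bullet> z1 = real_vec u \<bullet> z0 \<and> real_vec u \<bullet> z2 = real_vec u \<bullet> z0 \<and>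
    real m - (real_vec u \<bullet> z3 - real_vec u \<bullet> z0) \<le> real_vec v \<bullet> z2 - real_vec v \<bullet> z1"
proof -
  obtain \<sigma> where \<sigma>: "0 \<le> \<sigma>" "\<And>e. e \<in> A \<Longrightarrow> \<sigma> * (c e - \<mu>) \<le> of_int (idot u e) - real_vec u \<bullet> z0"
    using supporting_slope[OF fin min] by blast
  define \<phi> where "\<phi> = (\<lambda>p. real_vec u \<bullet> base p - real_vec u \<bullet> z0 - \<sigma> * (height p - \<mu>))"
  define long where "long = (\<lambda>z t. \<exists>z1\<in>level_section A c t. \<exists>z2\<in>level_section A c t. \<exists>z3\<in>level_section A c t.
    real_vec u \<bullet> z1 = real_vec u \<bullet> z \<and> real_vec u \<bullet> z2 = real_vec u \<bullet> z \<and>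
    real m - (real_vec u \<bullet> z3 - real_vec u \<bullet> z) \<le> real_vec v \<bullet> z2 - real_vec v \<bullet> z1)"
  define K where "K = {p. 0 < \<phi> p \<or> (\<phi> p = 0 \<and> long (base p) (height p))}"
  have \<phi>_comb: "\<phi> (a *\<^sub>R p + b *\<^sub>R q) = a * \<phi> p + b * \<phi> q" if ab: "a + b = 1" for a b p q
  proof -
    have b: "b = 1 - a" using ab by simp
    show ?thesis
      unfolding \<phi>_def base_comb height_comb inner_add_right inner_scaleR_right b
      by (simp add: algebra_simps)
  qed
  have long_comb: "long (a *\<^sub>R z + b *\<^sub>R w) (a * s + b * t)"
    if "long z s" "long w t" and ab: "0 \<le> a" "0 \<le> b" "a + b = 1" for a b s t z w
  proof -
    obtain z1 z2 z3 where z: "z1 \<in> level_section A c s" "z2 \<in> level_section A c s" "z3 \<in> level_section A c s"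
      "real_vec u \<bullet> z1 = real_vec u \<bullet> z" "real_vec u \<bullet> z2 = real_vec u \<bullet> z"
      "real m - (real_vec u \<bullet> z3 - real_vec u \<bullet> z) \<le> real_vec v \<bullet> z2 - real_vec v \<bullet> z1"
      using \<open>long z s\<close> unfolding long_def by blast
    obtain w1 w2 w3 where w: "w1 \<in> level_section A c t" "w2 \<in> level_section A c t" "w3 \<in> level_section A c t"
      "real_vec u \<bullet> w1 = real_vec u \<bullet> w" "real_vec u \<bullet> w2 = real_vec u \<bullet> w"
      "real m - (real_vec u \<bullet> w3 - real_vec u \<bullet> w) \<le> real_vec v \<bullet> w2 - real_vec v \<bullet> w1"
      using \<open>long w t\<close> unfolding long_def by blast
    have "a * (real m - (real_vec u \<bullet> z3 - real_vec u \<bullet> z)) + b * (real m - (real_vec u \<bullet> w3 - real_vec u \<bullet> w))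
      \<le> a * (real_vec v \<bullet> z2 - real_vec v \<bullet> z1) + b * (real_vec v \<bullet> w2 - real_vec v \<bullet> w1)"
      using z(6) w(6) ab by (intro add_mono mult_left_mono) auto
    moreover have "a * real m + b * real m = real m" using ab by (simp flip: distrib_right)
    ultimately show ?thesis
      unfolding long_def using z(4,5) w(4,5)
      by (intro bexI[of _ "a *\<^sub>R z1 + b *\<^sub>R w1"] bexI[of _ "a *\<^sub>R z2 + b *\<^sub>R w2"] bexI[of _ "a *\<^sub>R z3 + b *\<^sub>R w3"]
          level_section_comb z w ab conjI) (simp_all add: inner_add_right algebra_simps)
  qed
  have "subgraph_hull A c \<subseteq> K"
    unfolding subgraph_hull_def
  proof (rule hull_minimal)
    show "{(of_int i, of_int j, s) | i j s. (i, j) \<in> A \<and> s \<le> c (i, j)} \<subseteq> K"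
    proof clarify
      fix i j s assume e: "(i, j) \<in> A" and s: "s \<le> c (i, j)"
      define p where "p = (real_of_int i, real_of_int j, s)"
      define e where "e = (i, j)"
      have eA: "e \<in> A" "s \<le> c e" using \<open>(i, j) \<in> A\<close> s by (simp_all add: e_def)
      have p: "base p = real_vec e" "height p = s"
        by (simp_all add: p_def e_def base_def height_def real_vec_def)
      have \<phi>p: "\<phi> p = of_int (idot u e) - real_vec u \<bullet> z0 - \<sigma> * (s - \<mu>)"
        by (simp add: \<phi>_def p inner_real_vec)
      have "\<sigma> * (s - \<mu>) \<le> \<sigma> * (c e - \<mu>)" using \<sigma>(1) eA(2) by (intro mult_left_mono) auto
      then have "0 \<le> \<phi> p" using \<sigma>(2)[OF eA(1)] \<phi>p by linarith
      moreover have "long (base p) (height p)" if 0: "\<phi> p = 0"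
      proof -
        \<comment> \<open>If \<open>\<sigma> = 0\<close>, the column of \<open>e\<close> is the first one, and there is nothing to its left.\<close>
        have left: "\<forall>f\<in>A. idot u f < idot u e \<longrightarrow> c f < s"
        proof (intro ballI impI)
          fix f assume f: "f \<in> A" "idot u f < idot u e"
          then have "\<sigma> * (c f - \<mu>) < \<sigma> * (s - \<mu>)" using \<sigma>(2)[OF f(1)] 0 \<phi>p by simp
          then show "c f < s" using \<sigma>(1) by (simp add: mult_less_cancel_left)
        qed
        obtain e1 e2 e3 where E: "e1 \<in> A" "e2 \<in> A" "e3 \<in> A" "s \<le> c e1" "s \<le> c e2" "s \<le> c e3"
          "idot u e1 = idot u e" "idot u e2 = idot u e"
          "int m - (idot u e3 - idot u e) \<le> idot v e2 - idot v e1"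
          using spread[unfolded column_spread_def, rule_format, OF det eA left[rule_format]] by blast
        have "real_of_int (int m - (idot u e3 - idot u e)) \<le> real_of_int (idot v e2 - idot v e1)"
          using E(9) by (simp only: of_int_le_iff)
        then show ?thesis
          unfolding long_def p using E
          by (intro bexI[of _ "real_vec e1"] bexI[of _ "real_vec e2"] bexI[of _ "real_vec e3"]
              level_section_generator conjI) (simp_all add: inner_real_vec)
      qed
      ultimately show "(real_of_int i, real_of_int j, s) \<in> K"
        unfolding K_def p_def[symmetric] by auto
    qed
    show "convex K"
    proof (rule convexI)
      fix p q a b assume *: "p \<in> K" "q \<in> K" "0 \<le> (a::real)" "0 \<le> b" "a + b = 1"
      show "a *\<^sub>R p + b *\<^sub>R q \<in> K"
      proof (cases "a = 0 \<or> b = 0")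
        case True
        then show ?thesis using * by auto
      next
        case False
        then have ab: "0 < a" "0 < b" using * by auto
        have ge: "0 \<le> \<phi> p" "0 \<le> \<phi> q" using *(1,2) by (auto simp: K_def)
        show ?thesis
        proof (cases "\<phi> p = 0 \<and> \<phi> q = 0")
          case True
          then have "long (base p) (height p)" "long (base q) (height q)" using *(1,2) by (auto simp: K_def)
          then show ?thesis using True long_comb * by (simp add: K_def \<phi>_comb)
        next
          case False
          then consider "0 < \<phi> p" | "0 < \<phi> q" using ge by linarith
          then have "0 < a * \<phi> p + b * \<phi> q"
            using ab ge by cases (simp_all add: add_pos_nonneg add_nonneg_pos)
          then show ?thesis using *(5) by (simp add: K_def \<phi>_comb)
        qed
      qed
    qed
  qed
  moreover obtain p where "p \<in> subgraph_hull A c" "base p = z0" "height p = \<mu>"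
    using z0 unfolding in_level_section by blast
  ultimately have "long z0 \<mu>" by (auto simp: K_def \<phi>_def)
  then show ?thesis unfolding long_def .
qed

section \<open>Thickness of planar convex sets\<close>

text \<open>
  For primitive \<open>u\<close>, the direction of the sides perpendicular to \<open>u\<close>.
\<close>

definition orth :: "int \<times> int \<Rightarrow> int \<times> int" where
  "orth u = (- snd u, fst u)"

lemma primitive_orth: "primitive u \<Longrightarrow> primitive (orth u)"
  by (simp add: primitive_def orth_def coprime_commute)

lemma orth_perp: "real_vec (orth u) \<bullet> real_vec u = 0"
  by (simp add: real_vec_def orth_def)

lemma real_vec_uminus: "real_vec (- u) = - real_vec u"
  by (simp add: real_vec_def)

lemma primitive_uminus: "primitive u \<Longrightarrow> primitive (- u)"
  by (simp add: primitive_def)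

lemma primitive_nonzero: "primitive u \<Longrightarrow> real_vec u \<noteq> 0"
  by (auto simp: primitive_def real_vec_def zero_prod_def)

lemma ex_idet_eq_1:
  assumes "primitive u"
  shows "\<exists>v. idet u v = 1"
proof -
  obtain x y where "x * fst u + y * snd u = 1"
    using bezout_int[of "fst u" "snd u"] assms unfolding primitive_def by auto
  then show ?thesis by (intro exI[of _ "(- y, x)"]) (simp add: idet_def algebra_simps)
qed

text \<open>
  On the line orthogonal to \<open>u\<close>, the complementary coordinate \<open>v\<close> measures lattice length.
\<close>

lemma orth_coordinate:
  assumes "idet u v = 1" "real_vec u \<bullet> z = 0"
  shows "z = (real_vec v \<bullet> z) *\<^sub>R real_vec (orth u)"
proof -
  obtain x y where z: "z = (x, y)" by (cases z)
  have d: "of_int (fst u) * of_int (snd v) - of_int (snd u) * of_int (fst v) = (1 :: real)"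
    using assms(1) unfolding idet_def by (metis of_int_1 of_int_diff of_int_mult)
  have p: "of_int (fst u) * x + of_int (snd u) * y = 0"
    using assms(2) by (simp add: z real_vec_def)
  have "(of_int (fst v) * x + of_int (snd v) * y) * - of_int (snd u) =
      (of_int (fst u) * of_int (snd v) - of_int (snd u) * of_int (fst v)) * x
      - of_int (snd v) * (of_int (fst u) * x + of_int (snd u) * y)"
    "(of_int (fst v) * x + of_int (snd v) * y) * of_int (fst u) =
      (of_int (fst u) * of_int (snd v) - of_int (snd u) * of_int (fst v)) * y
      + of_int (fst v) * (of_int (fst u) * x + of_int (snd u) * y)"
    by (simp_all add: algebra_simps)
  then show ?thesis
    unfolding d p by (simp add: z real_vec_def orth_def)
qed

lemma collinear_in_line:
  assumes "primitive u" "\<And>z w. z \<in> S \<Longrightarrow> w \<in> S \<Longrightarrow> real_vec u \<bullet> z = real_vec u \<bullet> w"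
  shows "collinear S"
proof -
  obtain v where v: "idet u v = 1" using ex_idet_eq_1[OF assms(1)] by blast
  have "z - w = (real_vec v \<bullet> (z - w)) *\<^sub>R real_vec (orth u)" if "z \<in> S" "w \<in> S" for z w
    using assms(2)[OF that] by (intro orth_coordinate[OF v]) (simp add: inner_diff_right)
  then show ?thesis unfolding collinear_def by blast
qed

lemma width_upper:
  assumes "compact B" "x \<in> B" "y \<in> B"
  shows "real_vec u \<bullet> (x - y) \<le> width u B"
proof -
  have "bdd_above ((\<lambda>(x, y). real_vec u \<bullet> (x - y)) ` (B \<times> B))"
    unfolding case_prod_unfold
    by (intro bounded_imp_bdd_above compact_imp_bounded compact_continuous_image
        continuous_intros compact_Times assms)
  from cSUP_upper[OF _ this, of "(x, y)"] show ?thesis using assms by (simp add: width_def)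
qed

text \<open>
  The conclusion of \<open>level_section_left_face\<close> for an arbitrary planar set. Since \<open>u\<close> may be replaced by
  its negative, faces on both sides are covered.
\<close>

definition faces_long :: "nat \<Rightarrow> (real \<times> real) set \<Rightarrow> bool" where
  "faces_long m B \<longleftrightarrow> (\<forall>u v. idet u v = 1 \<longrightarrow> (\<forall>z0\<in>B. (\<forall>z\<in>B. real_vec u \<bullet> z0 \<le> real_vec u \<bullet> z) \<longrightarrow>
    (\<exists>z1\<in>B. \<exists>z2\<in>B. \<exists>z3\<in>B. real_vec u \<bullet> z1 = real_vec u \<bullet> z0 \<and> real_vec u \<bullet> z2 = real_vec u \<bullet> z0 \<and>
       real m - (real_vec u \<bullet> z3 - real_vec u \<bullet> z0) \<le> real_vec v \<bullet> z2 - real_vec v \<bullet> z1)))"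

lemma min_face_segment:
  assumes B: "compact B" "convex B" "faces_long m B" and u: "primitive u"
    and z0: "z0 \<in> B" "\<And>z. z \<in> B \<Longrightarrow> real_vec u \<bullet> z0 \<le> real_vec u \<bullet> z"
  obtains x y t z3 where "B \<inter> {z. real_vec u \<bullet> z = real_vec u \<bullet> z0} = closed_segment x y"
    "y - x = t *\<^sub>R real_vec (orth u)" "z3 \<in> B"
    "real m - (real_vec u \<bullet> z3 - real_vec u \<bullet> z0) \<le> \<bar>t\<bar>"
proof -
  define F where "F = B \<inter> {z. real_vec u \<bullet> z = real_vec u \<bullet> z0}"
  obtain v where v: "idet u v = 1" using ex_idet_eq_1[OF u] by blast
  have "compact F" unfolding F_def using B by (intro compact_Int_closed closed_hyperplane)
  moreover have "convex F" unfolding F_def using B by (intro convex_Int convex_hyperplane)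
  moreover have "collinear F" by (rule collinear_in_line[OF u]) (auto simp: F_def)
  moreover have "F \<noteq> {}" using z0 by (auto simp: F_def)
  ultimately obtain x y where F: "F = closed_segment x y"
    using compact_convex_collinear_segment by metis
  have "x \<in> F" "y \<in> F" by (simp_all add: F)
  then have yx: "y - x = (real_vec v \<bullet> (y - x)) *\<^sub>R real_vec (orth u)"
    by (intro orth_coordinate[OF v]) (simp add: F_def inner_diff_right)
  obtain z1 z2 z3 where z: "z1 \<in> B" "z2 \<in> B" "z3 \<in> B" "real_vec u \<bullet> z1 = real_vec u \<bullet> z0"
    "real_vec u \<bullet> z2 = real_vec u \<bullet> z0"
    "real m - (real_vec u \<bullet> z3 - real_vec u \<bullet> z0) \<le> real_vec v \<bullet> z2 - real_vec v \<bullet> z1"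
    using B(3) v z0 unfolding faces_long_def by meson
  then have "z1 \<in> F" "z2 \<in> F" by (auto simp: F_def)
  then obtain a1 a2 where a: "z1 = (1 - a1) *\<^sub>R x + a1 *\<^sub>R y" "z2 = (1 - a2) *\<^sub>R x + a2 *\<^sub>R y"
    "0 \<le> a1" "a1 \<le> 1" "0 \<le> a2" "a2 \<le> 1"
    unfolding F in_segment by blast
  have "real_vec v \<bullet> z2 - real_vec v \<bullet> z1 = (a2 - a1) * (real_vec v \<bullet> (y - x))"
    unfolding a(1,2) by (simp add: inner_add_right inner_diff_right algebra_simps)
  also have "\<dots> \<le> \<bar>a2 - a1\<bar> * \<bar>real_vec v \<bullet> (y - x)\<bar>" by (metis abs_ge_self abs_mult)
  also have "\<dots> \<le> 1 * \<bar>real_vec v \<bullet> (y - x)\<bar>" using a by (intro mult_right_mono) auto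
  finally show thesis using that[OF F[unfolded F_def] yx z(3)] z(6) by simp
qed

lemma has_lattice_length_segment:
  assumes "primitive d" "y - x = t *\<^sub>R real_vec d"
  shows "has_lattice_length (closed_segment x y) d \<bar>t\<bar>"
proof -
  have "dist x y = \<bar>t\<bar> * norm (real_vec d)"
    using assms(2) by (metis dist_commute dist_norm norm_scaleR)
  then have "\<bar>t\<bar> = dist x y / norm (real_vec d)" using primitive_nonzero[OF assms(1)] by simp
  then show ?thesis unfolding has_lattice_length_def using assms by blast
qed

lemma min_face_side:
  assumes B: "compact B" "convex B" "faces_long m B" and u: "primitive u"
    and z0: "z0 \<in> B" "\<And>z. z \<in> B \<Longrightarrow> real_vec u \<bullet> z0 \<le> real_vec u \<bullet> z"
    and r: "0 < r" "\<And>z. z \<in> B \<Longrightarrow> real_vec u \<bullet> z - real_vec u \<bullet> z0 \<le> real m - r"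
  shows "side_perp B u r (B \<inter> {z. real_vec u \<bullet> z = real_vec u \<bullet> z0})"
proof -
  obtain x y t z3 where s: "B \<inter> {z. real_vec u \<bullet> z = real_vec u \<bullet> z0} = closed_segment x y"
    "y - x = t *\<^sub>R real_vec (orth u)" "z3 \<in> B"
    "real m - (real_vec u \<bullet> z3 - real_vec u \<bullet> z0) \<le> \<bar>t\<bar>"
    using min_face_segment[OF B u z0] by metis
  have rt: "r \<le> \<bar>t\<bar>" using s(4) r(2)[OF s(3)] by linarith
  have "t *\<^sub>R real_vec (orth u) \<noteq> 0"
    using rt r(1) primitive_nonzero[OF primitive_orth[OF u]] by auto
  then have "x \<noteq> y" using s(2) by auto
  then have "aff_dim (closed_segment x y) = 1"
    unfolding segment_convex_hull aff_dim_convex_hull by simp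
  moreover have "(B \<inter> {z. real_vec u \<bullet> z = real_vec u \<bullet> z0}) face_of B"
    using B(2) z0(2) by (rule face_of_Int_supporting_hyperplane_ge)
  ultimately have "(B \<inter> {z. real_vec u \<bullet> z = real_vec u \<bullet> z0}) edge_of B"
    unfolding edge_of_def s(1) by simp
  then show ?thesis
    unfolding side_perp_def
    using has_lattice_length_segment[OF primitive_orth[OF u] s(2)] rt orth_perp[of u] s(1) by metis
qed

text \<open>
  Dirichlet's approximation theorem, applied to the slope of \<open>w\<close>.
\<close>

lemma ex_small_primitive_functional: "\<exists>u. primitive u \<and> \<bar>real_vec u \<bullet> w\<bar> < 1"
proof (cases "snd w = 0")
  case True
  then show ?thesis
    by (intro exI[of _ "(0, 1)"]) (simp add: primitive_def real_vec_def inner_prod_def)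
next
  case False
  define N where "N = nat \<lceil>\<bar>snd w\<bar>\<rceil>"
  have N: "0 < N" "\<bar>snd w\<bar> \<le> real N" using False by (auto simp: N_def)
  obtain h k where hk: "coprime h k" "0 < k" "\<bar>of_int k * (fst w / snd w) - of_int h\<bar> < 1 / real N"
    using Dirichlet_approx_coprime[OF N(1)] by metis
  have "\<bar>of_int k * fst w - of_int h * snd w\<bar> = \<bar>snd w\<bar> * \<bar>of_int k * (fst w / snd w) - of_int h\<bar>"
    unfolding abs_mult[symmetric] using False by (simp add: right_diff_distrib mult.commute)
  also have "\<dots> < \<bar>snd w\<bar> * (1 / real N)" using hk(3) False by (intro mult_strict_left_mono) auto
  also have "\<dots> \<le> 1" using N by simp
  finally have "\<bar>real_vec (k, - h) \<bullet> w\<bar> < 1" by (cases w) (simp add: real_vec_def)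
  moreover have "primitive (k, - h)" using hk(1) by (simp add: primitive_def coprime_commute)
  ultimately show ?thesis by blast
qed

lemma ex_min_functional:
  assumes "compact B" "B \<noteq> {}"
  obtains z0 where "z0 \<in> B" "\<And>z. z \<in> B \<Longrightarrow> real_vec u \<bullet> z0 \<le> real_vec u \<bullet> z"
proof -
  have "continuous_on B (\<lambda>z. real_vec u \<bullet> z)" by (intro continuous_intros)
  from continuous_attains_inf[OF assms this] show thesis using that by blast
qed

text \<open>
  In dimension 2 the faces where \<open>u\<close> is minimal and maximal are the two required sides. In dimension 0
  all three points coincide, against \<open>m > 0\<close>. In dimension 1 the rationality of the slope has to be
  proved: some primitive \<open>u\<close> has width less than 1 on the segment, and if \<open>u\<close> were not constant there,
  its minimal face would be a single point, although the width leaves it positive length. So \<open>u\<close> is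
  constant and its minimal face is the whole segment.
\<close>

lemma thick_of_faces_long:
  assumes B: "compact B" "convex B" "faces_long m B" and m: "0 < m"
  shows "thick m B"
proof (cases "B = {}")
  case False
  have hull: "convex hull B = B" using B(2) by (simp add: convex_hull_eq)
  have "0 \<le> aff_dim B" using False aff_dim_geq[of B] aff_dim_empty[of B] by linarith
  moreover have "aff_dim B \<le> 2" using aff_dim_le_DIM[of B] by simp
  ultimately consider "aff_dim B = 0" | "aff_dim B = 1" | "aff_dim B = 2" by linarith
  then show ?thesis
  proof cases
    case 1
    then obtain z where z: "B = {z}" using aff_dim_eq_0 by blast
    have "idet (1, 0) (0, 1) = 1" by (simp add: idet_def)
    then have "real m \<le> 0" using B(3) unfolding faces_long_def z by fastforce
    then show ?thesis using m by simp
  next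
    case 2
    then have "collinear B" by (simp add: collinear_aff_dim)
    then obtain x y where seg: "B = closed_segment x y"
      using compact_convex_collinear_segment[OF False B(1,2)] by blast
    have diff: "\<exists>s. \<bar>s\<bar> \<le> 1 \<and> z' - z = s *\<^sub>R (y - x)" if zz: "z \<in> B" "z' \<in> B" for z z'
    proof -
      obtain a b where ab: "z = (1 - a) *\<^sub>R x + a *\<^sub>R y" "z' = (1 - b) *\<^sub>R x + b *\<^sub>R y"
        "0 \<le> a" "a \<le> 1" "0 \<le> b" "b \<le> 1"
        using zz unfolding seg in_segment by blast
      have "z' - z = (b - a) *\<^sub>R (y - x)" unfolding ab(1,2) by (simp add: algebra_simps)
      moreover have "\<bar>b - a\<bar> \<le> 1" using ab(3-6) by linarith
      ultimately show ?thesis by blast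
    qed
    obtain u where u: "primitive u" "\<bar>real_vec u \<bullet> (y - x)\<bar> < 1"
      using ex_small_primitive_functional by blast
    obtain z0 where z0: "z0 \<in> B" "\<And>z. z \<in> B \<Longrightarrow> real_vec u \<bullet> z0 \<le> real_vec u \<bullet> z"
      using ex_min_functional[OF B(1) False] by blast
    obtain x' y' t z3 where s: "B \<inter> {z. real_vec u \<bullet> z = real_vec u \<bullet> z0} = closed_segment x' y'"
      "y' - x' = t *\<^sub>R real_vec (orth u)" "z3 \<in> B"
      "real m - (real_vec u \<bullet> z3 - real_vec u \<bullet> z0) \<le> \<bar>t\<bar>"
      using min_face_segment[OF B u(1) z0] by metis
    have "x' \<in> closed_segment x' y'" "y' \<in> closed_segment x' y'" by simp_all
    then have x'y': "x' \<in> B" "y' \<in> B" "real_vec u \<bullet> x' = real_vec u \<bullet> y'"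
      unfolding s(1)[symmetric] by auto
    have u0: "real_vec u \<bullet> (y - x) = 0"
    proof (rule ccontr)
      assume n0: "real_vec u \<bullet> (y - x) \<noteq> 0"
      obtain s1 where s1: "y' - x' = s1 *\<^sub>R (y - x)" using diff[OF x'y'(1,2)] by blast
      then have "s1 * (real_vec u \<bullet> (y - x)) = real_vec u \<bullet> (y' - x')" by simp
      then have "s1 = 0" using x'y'(3) n0 by (simp add: inner_diff_right)
      then have "t = 0" using s1 s(2) primitive_nonzero[OF primitive_orth[OF u(1)]] by simp
      obtain s2 where s2: "\<bar>s2\<bar> \<le> 1" "z3 - z0 = s2 *\<^sub>R (y - x)" using diff[OF z0(1) s(3)] by blast
      have "real_vec u \<bullet> z3 - real_vec u \<bullet> z0 = s2 * (real_vec u \<bullet> (y - x))"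
        using s2(2) by (metis inner_diff_right inner_scaleR_right)
      also have "\<dots> \<le> \<bar>s2\<bar> * \<bar>real_vec u \<bullet> (y - x)\<bar>" by (metis abs_ge_self abs_mult)
      also have "\<dots> \<le> 1 * \<bar>real_vec u \<bullet> (y - x)\<bar>" using s2(1) by (intro mult_right_mono) auto
      finally have "real m < 1" using s(4) \<open>t = 0\<close> u(2) by linarith
      then show False using m by simp
    qed
    have const: "real_vec u \<bullet> z = real_vec u \<bullet> z0" if z: "z \<in> B" for z
    proof -
      obtain s1 where "z - z0 = s1 *\<^sub>R (y - x)" using diff[OF z0(1) z] by blast
      then have "real_vec u \<bullet> (z - z0) = 0" using u0 by simp
      then show ?thesis by (simp add: inner_diff_right)
    qed
    have "B = closed_segment x' y'" using s(1) const by blast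
    moreover have "real m \<le> \<bar>t\<bar>" using s(4) const[OF s(3)] by simp
    ultimately have "\<exists>d r. has_lattice_length B d r \<and> real m \<le> r"
      using has_lattice_length_segment[OF primitive_orth[OF u(1)] s(2)] by metis
    then show ?thesis unfolding thick_def hull using B(1) 2 by blast
  next
    case 3
    have "\<exists>S T. S \<noteq> T \<and> side_perp B u r S \<and> side_perp B u r T"
      if u: "primitive u" "0 < r" "width u B = real m - r" for u r
    proof -
      obtain z0 where z0: "z0 \<in> B" "\<And>z. z \<in> B \<Longrightarrow> real_vec u \<bullet> z0 \<le> real_vec u \<bullet> z"
        using ex_min_functional[OF B(1) False] by blast
      obtain z1 where z1: "z1 \<in> B" "\<And>z. z \<in> B \<Longrightarrow> real_vec (- u) \<bullet> z1 \<le> real_vec (- u) \<bullet> z"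
        using ex_min_functional[OF B(1) False] by blast
      define S where "S = B \<inter> {z. real_vec u \<bullet> z = real_vec u \<bullet> z0}"
      define T where "T = B \<inter> {z. real_vec (- u) \<bullet> z = real_vec (- u) \<bullet> z1}"
      have "side_perp B u r S"
        unfolding S_def using width_upper[OF B(1) _ z0(1), of _ u] u(3)
        by (intro min_face_side[OF B u(1) z0 u(2)]) (simp_all add: inner_diff_right)
      moreover have "side_perp B (- u) r T"
        unfolding T_def using width_upper[OF B(1) z1(1), of _ u] u(3)
        by (intro min_face_side[OF B primitive_uminus[OF u(1)] z1 u(2)])
          (simp_all add: inner_diff_right real_vec_uminus)
      then have "side_perp B u r T" by (simp add: side_perp_def real_vec_uminus)
      moreover have "S \<noteq> T"
      proof
        assume "S = T"
        then have "z0 \<in> T" using z0(1) by (auto simp: S_def)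
        then have eq: "real_vec u \<bullet> z0 = real_vec u \<bullet> z1" by (simp add: T_def real_vec_uminus)
        have "real_vec u \<bullet> z = real_vec u \<bullet> z0" if "z \<in> B" for z
          using z0(2)[OF that] z1(2)[OF that] eq by (simp add: real_vec_uminus)
        then have "collinear B" by (intro collinear_in_line[OF u(1)]) simp
        then show False using 3 by (simp add: collinear_aff_dim)
      qed
      ultimately show ?thesis by blast
    qed
    then have "\<forall>u r. primitive u \<and> r > 0 \<and> width u B = real m - r \<longrightarrow>
        (\<exists>S T. S \<noteq> T \<and> side_perp B u r S \<and> side_perp B u r T)"
      by simp
    with B(1) 3 show ?thesis unfolding thick_def hull by simp
  qed
qed (simp add: thick_def)

text \<open>
  Lowering \<open>m\<close> lowers the defect \<open>m - width\<close>, and with it the required length of the sides, by the same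
  amount.
\<close>

lemma thick_antimono:
  assumes "thick n B" "m \<le> n"
  shows "thick m B"
proof -
  let ?C = "convex hull B"
  have mn: "real m \<le> real n" using assms(2) by simp
  have weaken: "\<exists>S T. S \<noteq> T \<and> side_perp ?C u r S \<and> side_perp ?C u r T"
    if n: "\<forall>u r. primitive u \<and> r > 0 \<and> width u ?C = real n - r \<longrightarrow>
        (\<exists>S T. S \<noteq> T \<and> side_perp ?C u r S \<and> side_perp ?C u r T)"
      and ur: "primitive u \<and> r > 0 \<and> width u ?C = real m - r" for u r
  proof -
    define q where "q = r + (real n - real m)"
    have "r \<le> q" "0 < q" "width u ?C = real n - q" using ur mn by (auto simp: q_def)
    then obtain S T where "S \<noteq> T" "side_perp ?C u q S" "side_perp ?C u q T"
      using n ur by blast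
    moreover have "side_perp ?C u r X" if "side_perp ?C u q X" for X
      using that \<open>r \<le> q\<close> unfolding side_perp_def by (meson order_trans)
    ultimately show ?thesis by blast
  qed
  consider "B = {}" | "aff_dim ?C = 1" "\<exists>d r. has_lattice_length ?C d r \<and> real n \<le> r"
    | "aff_dim ?C = 2" "\<forall>u r. primitive u \<and> r > 0 \<and> width u ?C = real n - r \<longrightarrow>
        (\<exists>S T. S \<noteq> T \<and> side_perp ?C u r S \<and> side_perp ?C u r T)"
    using assms(1) unfolding thick_def by blast
  then show ?thesis
  proof cases
    case 1
    then show ?thesis by (simp add: thick_def)
  next
    case 2
    then have "\<exists>d r. has_lattice_length ?C d r \<and> real m \<le> r" using mn by (meson order_trans)
    then show ?thesis using assms(1) 2(1) by (simp add: thick_def)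
  next
    case 3
    have "\<forall>u r. primitive u \<and> r > 0 \<and> width u ?C = real m - r \<longrightarrow>
        (\<exists>S T. S \<noteq> T \<and> side_perp ?C u r S \<and> side_perp ?C u r T)"
      using weaken[OF 3(2)] by blast
    with assms(1) 3(1) show ?thesis by (simp add: thick_def)
  qed
qed

section \<open>Points of a curve\<close>

text \<open>
  The tropical terms at the valuation of \<open>p\<close> are the valuations of the terms of \<open>F\<close> at \<open>p\<close>.
\<close>

lemma (in valuation_field) val_term_at_Val:
  assumes "a i j \<noteq> 0" "p1 \<noteq> 0" "p2 \<noteq> 0"
  shows "val (a i j * p1 powi i * p2 powi j) = ereal (trop_term val a (Val val (p1, p2)) (i, j))"
  using val_finite[OF assms(1)]
  unfolding val_mult val_powi[OF assms(2)] val_powi[OF assms(3)] trop_term_def Val_def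
  by (cases "val (a i j)") auto

text \<open>
  Rescaling the variables moves \<open>p\<close> to \<open>(1, 1)\<close> and turns the coefficients of \<open>F\<close> into its terms at \<open>p\<close>.
\<close>

lemma taylor_coeff_scaled:
  assumes "p1 \<noteq> 0" "p2 \<noteq> 0"
  shows "p1 ^ k * p2 ^ l * taylor_coeff A a (p1, p2) k l =
    (\<Sum>(i, j)\<in>A. (a i j * p1 powi i * p2 powi j) * (ibin i k * ibin j l))"
proof -
  have "p1 ^ k * p2 ^ l * (a i j * fps_nth ((fps_const p1 + fps_X) powi i) k * fps_nth ((fps_const p2 + fps_X) powi j) l)
    = (a i j * p1 powi i * p2 powi j) * (ibin i k * ibin j l)" for i j
  proof -
    have rearrange: "p1 ^ k * p2 ^ l * (a i j * f * g) = a i j * (p1 ^ k * f) * (p2 ^ l * g)" for f g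
      by (simp only: mult_ac)
    show ?thesis
      unfolding rearrange fps_shifted_X_powi_nth[OF assms(1)] fps_shifted_X_powi_nth[OF assms(2)] by (simp only: mult_ac)
  qed
  then show ?thesis
    unfolding taylor_coeff_def sum_distrib_left case_prod_unfold fst_conv snd_conv by (simp only:)
qed

theorem lemma3p8:
  fixes val :: "'k::field \<Rightarrow> ereal"
    and A :: "(int \<times> int) set"
    and a :: "int \<Rightarrow> int \<Rightarrow> 'k"
    and p :: "'k \<times> 'k"
    and P :: "real \<times> real"
    and m :: nat
  assumes "valuation_field val"
    and "finite A" and "A \<noteq> {}"
    and "\<And>i j. (i, j) \<in> A \<Longrightarrow> a i j \<noteq> 0"
    and "p \<in> laurent_curve A a"
    and "curve_mult A a p = m"
    and "P = Val val p"
  shows "trop_mult_at_least val A a P m"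
proof -
  interpret valuation_field val by fact
  obtain p1 p2 where p: "p = (p1, p2)" by (cases p)
  have nz: "p1 \<noteq> 0" "p2 \<noteq> 0" using assms(5) by (auto simp: laurent_curve_def p)
  define b where "b = (\<lambda>i j. a i j * p1 powi i * p2 powi j)"
  define c where "c = trop_term val a P"
  have val_b: "val (b i j) = ereal (c (i, j))" if "(i, j) \<in> A" for i j
    using val_term_at_Val[where a = a, OF assms(4)[OF that] nz] by (simp add: b_def c_def assms(7) p)
  have sum_b: "(\<Sum>(i, j)\<in>A. b i j) = 0" using assms(5) by (simp add: laurent_curve_def p b_def)
  \<comment> \<open>The constant Taylor coefficient vanishes because \<open>p\<close> is on the curve, the others of order below
    \<open>m\<close> by minimality of \<open>m\<close>. So all coefficients of order below the positive number
    \<open>M\<close> vanish.\<close>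
  define M where "M = max 1 m"
  have vanish: "(\<Sum>(i, j)\<in>A. b i j * (ibin i k * ibin j l)) = 0" if kl: "k + l < M" for k l
  proof (cases "k + l < m")
    case True
    then have "taylor_coeff A a p k l = 0"
      using not_less_Least[of "k + l" "\<lambda>n. \<exists>k l. k + l = n \<and> taylor_coeff A a p k l \<noteq> 0"] assms(6)
      unfolding curve_mult_def by blast
    then show ?thesis using taylor_coeff_scaled[OF nz, of k l A a] by (simp add: p b_def)
  next
    case False
    then have "k = 0" "l = 0" using kl by (auto simp: M_def max_def split: if_splits)
    then show ?thesis using sum_b by simp
  qed
  have spread: "column_spread M A c"
    using column_spread_of_vanishing[OF assms(2) val_b vanish] .
  have "thick m (hull_section val A a P \<mu>)" for \<mu>
  proof (rule thick_antimono[of M])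
    have sec: "hull_section val A a P \<mu> = level_section A c \<mu>"
      by (simp add: hull_section_def level_section_def extended_hull_def subgraph_hull_def c_def)
    have "faces_long M (level_section A c \<mu>)"
      unfolding faces_long_def using level_section_left_face[OF assms(2) spread] by simp
    moreover have "0 < M" by (simp add: M_def)
    ultimately show "thick M (hull_section val A a P \<mu>)"
      unfolding sec using compact_level_section[OF assms(2)] convex_level_section
      by (intro thick_of_faces_long)
  qed (simp add: M_def)
  moreover have "P \<in> Trop val A a"
  proof -
    define E where "E = {e \<in> A. c e = Max (c ` A)}"
    have finE: "finite E" using assms(2) by (simp add: E_def)
    obtain e where e: "e \<in> A" "\<forall>f\<in>A. c f \<le> c e" using ex_maximizer[OF assms(2,3), of c] by blast
    have max_eq: "Max (c ` A) = c e" using e assms(2) by (intro Max_eqI) auto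
    have val_b': "val (case f of (i, j) \<Rightarrow> b i j) = ereal (c f)" if "f \<in> A" for f
      using val_b that by (cases f) auto
    have "(case e of (i, j) \<Rightarrow> b i j) \<noteq> 0"
      using val_b'[OF e(1)] val_eq_MInf_iff[of "case e of (i, j) \<Rightarrow> b i j"] by auto
    then obtain f where f: "f \<in> A" "f \<noteq> e" "val (case e of (i, j) \<Rightarrow> b i j) \<le> val (case f of (i, j) \<Rightarrow> b i j)"
      using no_dominant_term_of_sum_eq_0[OF assms(2) sum_b e(1)] by blast
    then have "c f = c e" using e(2) val_b' e(1) by (simp add: order_antisym)
    then have "{e, f} \<subseteq> E" using e f by (simp add: E_def max_eq)
    then have "2 \<le> card E" using card_mono[OF finE, of "{e, f}"] f(2) by simp
    then show ?thesis by (simp add: Trop_def E_def c_def)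
  qed
  ultimately show ?thesis by (simp add: trop_mult_at_least_def)
qed

end
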